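(* Let $K$ be a field of characteristic zero, let $k\geq 2$ be an integer, and in the free associative algebra $K\langle x,y\rangle$ let \[ u=(xy)^kx,\quad v=xy,\quad w=yx, \] \[ f=u^3+r,\quad r=uv+uw+wu, \] \[ g=u^2+s,\quad s=v+w. \] Then $f$ and $g$ are algebraically independent polynomials which generate their centralizers $C(f)$ and $C(g)$ in $K\langle x,y\rangle$, respectively. The homogeneous components of maximal degree of $f$ and $g$ are algebraically dependent, and neither of the degrees of $f$ and $g$ divides the other. Moreover, \[ \deg([f,g])<\deg(g)<\deg(f). \] The quotient \[ \frac{\deg([f,g])}{\deg(g)}=\frac{1}{2}+\frac{2}{2k+1} \] is bigger than $1/2$ but can be made as close to $1/2$ as we want by increasing $k$.
   Context: $K\langle x,y\rangle$ is the free associative unital $K$-algebra on $x,y$, and $\deg$ is the usual total degree ($\deg x=\deg y=1$). $[f,g]=fg-gf$. Two elements $f,g\in K\langle x,y\rangle$ are algebraically dependent if there is a nonzero polynomial $p$ in the free associative algebra on two generators with $p(f,g)=0$, and algebraically independent otherwise. The centralizer $C(f)$ is the set of all elements of $K\langle x,y\rangle$ commuting with $f$; "$f$ generates its centralizer" means $C(f)=K[f]$, the unital subalgebra generated by $f$. *)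

theory Defs
  imports Complex_Main "HOL-Library.Poly_Mapping"
begin

text \<open>The free monoid on \<open>'g\<close>, written additively because the ring instance of
  \<^type>\<open>poly_mapping\<close> (the monoid algebra) expects an additive index monoid.\<close>

datatype 'g word = Word (letters: "'g list")

instantiation word :: (type) monoid_add
begin

definition zero_word :: "'a word" where
  "0 = Word []"

definition plus_word :: "'a word \<Rightarrow> 'a word \<Rightarrow> 'a word" where
  "a + b = Word (letters a @ letters b)"

instance
  by standard (simp_all add: zero_word_def plus_word_def)

end

datatype gen = X | Y

text \<open>\<open>'k free_algebra\<close> is the free associative unital algebra on two generators over \<open>'k\<close>;
  it is a ring by the instances for \<^type>\<open>poly_mapping\<close>.\<close>

type_synonym 'k free_algebra = "gen word \<Rightarrow>\<^sub>0 'k"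

definition var :: "gen \<Rightarrow> 'k::field free_algebra" where
  "var i = Poly_Mapping.single (Word [i]) 1"

definition scalar :: "'k::field \<Rightarrow> 'k free_algebra" where
  "scalar c = Poly_Mapping.single 0 c"

text \<open>Total degree; the value at \<open>0\<close> is \<open>0\<close> by convention.\<close>

definition deg :: "'k::field free_algebra \<Rightarrow> nat" where
  "deg f = Max (insert 0 ((\<lambda>m. length (letters m)) ` Poly_Mapping.keys f))"

definition homogeneous_component :: "nat \<Rightarrow> 'k::field free_algebra \<Rightarrow> 'k free_algebra" where
  "homogeneous_component d f =
     (\<Sum>m \<in> {m \<in> Poly_Mapping.keys f. length (letters m) = d}.
        Poly_Mapping.single m (Poly_Mapping.lookup f m))"

definition leading_form :: "'k::field free_algebra \<Rightarrow> 'k free_algebra" where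
  "leading_form f = homogeneous_component (deg f) f"

text \<open>\<open>substitute p a b\<close> is \<open>p(a, b)\<close>: the noncommutative polynomial \<open>p\<close> evaluated at
  \<open>X \<mapsto> a\<close>, \<open>Y \<mapsto> b\<close>.\<close>

definition substitute ::
  "'k::field free_algebra \<Rightarrow> 'k free_algebra \<Rightarrow> 'k free_algebra \<Rightarrow> 'k free_algebra" where
  "substitute p a b =
     (\<Sum>m \<in> Poly_Mapping.keys p. scalar (Poly_Mapping.lookup p m) *
        prod_list (map (case_gen a b) (letters m)))"

definition algebraically_dependent :: "'k::field free_algebra \<Rightarrow> 'k free_algebra \<Rightarrow> bool" where
  "algebraically_dependent a b \<longleftrightarrow> (\<exists>p. p \<noteq> 0 \<and> substitute p a b = 0)"

abbreviation algebraically_independent :: "'k::field free_algebra \<Rightarrow> 'k free_algebra \<Rightarrow> bool" where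
  "algebraically_independent a b \<equiv> \<not> algebraically_dependent a b"

definition commutator :: "'k::field free_algebra \<Rightarrow> 'k free_algebra \<Rightarrow> 'k free_algebra" where
  "commutator a b = a * b - b * a"

definition centralizer :: "'k::field free_algebra \<Rightarrow> 'k free_algebra set" where
  "centralizer a = {b. a * b = b * a}"

definition unital_subalgebra :: "'k::field free_algebra set \<Rightarrow> bool" where
  "unital_subalgebra A \<longleftrightarrow>
     1 \<in> A \<and> (\<forall>a\<in>A. \<forall>b\<in>A. a + b \<in> A \<and> a * b \<in> A) \<and> (\<forall>c. \<forall>a\<in>A. scalar c * a \<in> A)"

definition generates_centralizer :: "'k::field free_algebra \<Rightarrow> bool" where
  "generates_centralizer a \<longleftrightarrow> centralizer a = unital_subalgebra hull {a}"

definition u_poly :: "nat \<Rightarrow> 'k::field free_algebra" where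
  "u_poly k = (var X * var Y) ^ k * var X"

definition v_poly :: "'k::field free_algebra" where
  "v_poly = var X * var Y"

definition w_poly :: "'k::field free_algebra" where
  "w_poly = var Y * var X"

definition r_poly :: "nat \<Rightarrow> 'k::field free_algebra" where
  "r_poly k = u_poly k * v_poly + u_poly k * w_poly + w_poly * u_poly k"

definition s_poly :: "'k::field free_algebra" where
  "s_poly = v_poly + w_poly"

definition f_poly :: "nat \<Rightarrow> 'k::field free_algebra" where
  "f_poly k = u_poly k ^ 3 + r_poly k"

definition g_poly :: "nat \<Rightarrow> 'k::field free_algebra" where
  "g_poly k = u_poly k ^ 2 + s_poly"

end

theory Submission
  imports Defs
begin

text \<open>
  Everything except the commutator is read off from leading words with respect to an ordering
  of the words that is adapted to \<open>k\<close>.  Give \<open>x\<close> the weight \<open>-k\<close> and \<open>y\<close> the weight \<open>k + 1\<close>.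
  Then \<open>u = (xy)\<^sup>k x\<close> has weight \<open>0\<close>, while \<open>v = xy\<close> and \<open>w = yx\<close> have weight \<open>1\<close>.  So the
  powers of \<open>u\<close>, which dominate \<open>f\<close> and \<open>g\<close> in the usual degree, drop below \<open>r\<close> and \<open>s\<close> when
  words are compared by weight first.  Breaking ties lexicographically, \<open>f\<close> has the leading word
  \<open>wu = yx(xy)\<^sup>k x\<close> and \<open>g\<close> has the leading word \<open>w = yx\<close>, both of weight \<open>1\<close>.

  These two words form a code: distinct products of them are distinct words.  Hence the
  products of copies of \<open>f\<close> and \<open>g\<close> have distinct leading words, and no nontrivial linear
  combination of them vanishes (\<open>algebraically_independent_if_code\<close>).

  For the centralizers, an element commuting with \<open>f\<close> has a leading word that commutes with that
  of \<open>f\<close>.  Commuting words are powers of a common word, and a word of weight \<open>1\<close> is not a proper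
  power, so this leading word is the leading word of some \<open>f\<^sup>n\<close>.  Subtracting a multiple of
  \<open>f\<^sup>n\<close> lowers it, and since the weight of the leading word of \<open>f\<close> is positive the exponents
  decrease and the process stops (\<open>in_subalgebra_if_commutes\<close>).  The same works for \<open>g\<close>.

  The short commutator comes from the word identity \<open>vu = uw\<close>.  It makes all terms of
  \<open>[u\<^sup>3, s] + [r, u\<^sup>2]\<close> cancel, so that \<open>[f, g] = [r, s] = uvv + uvw - vwu - wwu\<close>, which has degree
  \<open>2k + 5\<close>; the degrees of \<open>f\<close> and \<open>g\<close> are \<open>6k + 3\<close> and \<open>4k + 2\<close>.
\<close>

section \<open>Leading terms in monoid algebras\<close>

locale ordered_index_monoid =
  fixes less :: "'a::monoid_add \<Rightarrow> 'a \<Rightarrow> bool" (infix "\<prec>" 50)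
  assumes irrefl: "\<not> a \<prec> a"
    and trans: "a \<prec> b \<Longrightarrow> b \<prec> c \<Longrightarrow> a \<prec> c"
    and total: "a \<noteq> b \<Longrightarrow> a \<prec> b \<or> b \<prec> a"
    and add_left: "a \<prec> b \<Longrightarrow> c + a \<prec> c + b"
    and add_right: "a \<prec> b \<Longrightarrow> a + c \<prec> b + c"
begin

definition below :: "'a \<Rightarrow> ('a \<Rightarrow>\<^sub>0 'b::field) \<Rightarrow> bool" where
  "below w p \<longleftrightarrow> (\<forall>m \<in> Poly_Mapping.keys p. m \<prec> w)"

text \<open>Splitting off the leading term, instead of speaking of a largest key and its coefficient,
  lets products be expanded by ring arithmetic without unfolding the convolution.\<close>

definition leads :: "'b::field \<Rightarrow> 'a \<Rightarrow> ('a \<Rightarrow>\<^sub>0 'b) \<Rightarrow> bool" where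
  "leads c w p \<longleftrightarrow> c \<noteq> 0 \<and> below w (p - Poly_Mapping.single w c)"

lemma below_add: "below w p \<Longrightarrow> below w q \<Longrightarrow> below w (p + q)"
  using keys_add[of p q] by (auto simp: below_def)

lemma below_diff: "below w p \<Longrightarrow> below w q \<Longrightarrow> below w (p - q)"
  using keys_diff[of p q] by (auto simp: below_def)

lemma below_single: "m \<prec> w \<Longrightarrow> below w (Poly_Mapping.single m c)"
  by (simp add: below_def)

lemma leads_single: "c \<noteq> 0 \<Longrightarrow> leads c w (Poly_Mapping.single w c)"
  by (simp add: leads_def below_def)

lemma leads_add_below: "leads c w p \<Longrightarrow> below w q \<Longrightarrow> leads c w (p + q)"
  using below_add[of w "p - Poly_Mapping.single w c" q]
  by (simp add: leads_def algebra_simps)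

lemma leads_nonzero: "leads c w p \<Longrightarrow> c \<noteq> 0"
  by (simp add: leads_def)

lemma below_diff_if_leads: "leads c w p \<Longrightarrow> leads c w q \<Longrightarrow> below w (p - q)"
  using below_diff[of w "p - Poly_Mapping.single w c" "q - Poly_Mapping.single w c"]
  by (simp add: leads_def)

lemma leads_lookup:
  assumes "leads c w p"
  shows "Poly_Mapping.lookup p w = c"
proof -
  have "w \<notin> Poly_Mapping.keys (p - Poly_Mapping.single w c)"
    using assms irrefl by (auto simp: leads_def below_def)
  then show ?thesis
    by (simp add: in_keys_iff lookup_minus)
qed

lemma leads_in_keys: "leads c w p \<Longrightarrow> w \<in> Poly_Mapping.keys p"
  using leads_lookup[of c w p] by (simp add: leads_nonzero in_keys_iff)

lemma leads_keys:
  assumes "leads c w p" "m \<in> Poly_Mapping.keys p"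
  shows "m = w \<or> m \<prec> w"
proof (cases "m = w")
  case False
  then have "m \<in> Poly_Mapping.keys (p - Poly_Mapping.single w c)"
    using assms(2) by (simp add: in_keys_iff lookup_minus lookup_single_not_eq)
  then show ?thesis
    using assms(1) by (auto simp: leads_def below_def)
qed simp

lemma leads_unique: "leads c w p \<Longrightarrow> leads d v p \<Longrightarrow> w = v"
  using leads_keys leads_in_keys irrefl trans by metis

lemma finite_maximum:
  assumes "finite A" "A \<noteq> {}"
  shows "\<exists>w\<in>A. \<forall>m\<in>A. m = w \<or> m \<prec> w"
  using assms
proof (induction rule: finite_ne_induct)
  case (insert a A)
  then obtain w where "w \<in> A" "\<forall>m\<in>A. m = w \<or> m \<prec> w"
    by blast
  then show ?case
    using total[of a w] trans by (metis insert_iff)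
qed simp

lemma leads_exists:
  assumes "p \<noteq> 0"
  obtains w where "leads (Poly_Mapping.lookup p w) w p"
proof -
  obtain w where w: "w \<in> Poly_Mapping.keys p"
      "\<And>m. m \<in> Poly_Mapping.keys p \<Longrightarrow> m = w \<or> m \<prec> w"
    using finite_maximum[of "Poly_Mapping.keys p"] assms by auto
  have "m \<prec> w"
    if "m \<in> Poly_Mapping.keys (p - Poly_Mapping.single w (Poly_Mapping.lookup p w))" for m
    using that w(2)[of m]
    by (cases "m = w") (auto simp: in_keys_iff lookup_minus lookup_single_not_eq)
  then show thesis
    using w(1) that[of w] by (simp add: leads_def below_def in_keys_iff)
qed

lemma below_mult_left:
  assumes "\<And>m. m \<in> Poly_Mapping.keys p \<Longrightarrow> m = v \<or> m \<prec> v" "below w q"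
  shows "below (v + w) (p * q)"
proof -
  have "a + b \<prec> v + w" if "a \<in> Poly_Mapping.keys p" "b \<in> Poly_Mapping.keys q" for a b
    using assms(1)[OF that(1)] assms(2) that(2) add_left[of b w a] add_right[of a v w] trans
    by (metis below_def)
  then show ?thesis
    using keys_mult[of p q] by (fastforce simp: below_def)
qed

lemma below_mult_right:
  assumes "below v p" "\<And>m. m \<in> Poly_Mapping.keys q \<Longrightarrow> m = w \<or> m \<prec> w"
  shows "below (v + w) (p * q)"
proof -
  have "a + b \<prec> v + w" if "a \<in> Poly_Mapping.keys p" "b \<in> Poly_Mapping.keys q" for a b
    using assms(2)[OF that(2)] assms(1) that(1) add_right[of a v b] add_left[of b w v] trans
    by (metis below_def)
  then show ?thesis
    using keys_mult[of p q] by (fastforce simp: below_def)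
qed

lemma leads_mult:
  assumes p: "leads c v p" and q: "leads d w q"
  shows "leads (c * d) (v + w) (p * q)"
proof -
  let ?s = "Poly_Mapping.single v c" and ?t = "Poly_Mapping.single w d"
  have "p * q - ?s * ?t = (p - ?s) * q + ?s * (q - ?t)"
    by (simp add: algebra_simps)
  moreover have "below (v + w) ((p - ?s) * q)"
    using p leads_keys[OF q] by (intro below_mult_right) (auto simp: leads_def)
  moreover have "below (v + w) (?s * (q - ?t))"
    using q by (intro below_mult_left) (auto simp: leads_def split: if_splits)
  ultimately have "below (v + w) (p * q - ?s * ?t)"
    by (simp add: below_add)
  then show ?thesis
    using p q by (simp add: leads_def mult_single)
qed

lemma leads_power:
  "leads 1 w p \<Longrightarrow> leads 1 (sum_list (replicate n w)) (p ^ n)"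
proof (induction n)
  case 0
  show ?case
    using leads_single[of "1 :: 'b" 0] by simp
next
  case (Suc n)
  then show ?case
    using leads_mult[of 1 w p 1] by simp
qed

lemma multiples_strict_mono_inverse:
  assumes "0 \<prec> w" "sum_list (replicate m w) \<prec> sum_list (replicate n w)"
  shows "m < n"
proof (rule ccontr)
  assume "\<not> m < n"
  then have split: "sum_list (replicate m w) = sum_list (replicate n w) + sum_list (replicate (m - n) w)"
    by (simp flip: sum_list_append replicate_add)
  have "sum_list (replicate j w) = 0 \<or> 0 \<prec> sum_list (replicate j w)" for j
  proof (induction j)
    case (Suc j)
    then show ?case
      using assms(1) add_left[of 0 "sum_list (replicate j w)" w] trans by auto
  qed simp
  then have "sum_list (replicate m w) = sum_list (replicate n w)
      \<or> sum_list (replicate n w) \<prec> sum_list (replicate m w)"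
    unfolding split using add_left[of 0 _ "sum_list (replicate n w)"] by (metis add_0_right)
  then show False
    using assms(2) irrefl trans by metis
qed

end

section \<open>Algebraic independence and centralizers via leading words\<close>

lemma scalar_commute: "p * scalar c = scalar c * p"
proof -
  have "p = (\<Sum>m\<in>Poly_Mapping.keys p. Poly_Mapping.single m (Poly_Mapping.lookup p m))"
    by (rule poly_mapping_eqI) (simp add: lookup_sum lookup_single when_def in_keys_iff)
  \<comment> \<open>Naming the summands lets \<open>p\<close> be unfolded without reappearing on the right.\<close>
  then obtain A and t :: "gen word \<Rightarrow> 'a" where p: "p = (\<Sum>m\<in>A. Poly_Mapping.single m (t m))"
    by blast
  show ?thesis
    unfolding p by (simp add: scalar_def sum_distrib_left sum_distrib_right mult_single mult.commute)
qed

lemma unital_subalgebra_centralizer: "unital_subalgebra (centralizer a)"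
proof -
  have "a * (scalar c * b) = scalar c * b * a" if "a * b = b * a" for b c
    by (metis scalar_commute mult.assoc that)
  moreover have "a * (b * c) = b * c * a" if "a * b = b * a" "a * c = c * a" for b c
    by (metis mult.assoc that)
  ultimately show ?thesis
    by (auto simp: unital_subalgebra_def centralizer_def algebra_simps)
qed

locale ordered_words = ordered_index_monoid less
  for less :: "gen word \<Rightarrow> gen word \<Rightarrow> bool" (infix "\<prec>" 50)
begin

lemma leads_scalar: "c \<noteq> 0 \<Longrightarrow> leads c 0 (scalar c)"
  by (simp add: scalar_def leads_single)

lemma leads_monomial_value:
  assumes "leads 1 a f" "leads 1 b g"
  shows "leads 1 (sum_list (map (case_gen a b) l)) (prod_list (map (case_gen f g) l))"
proof (induction l)
  case Nil
  show ?case
    using leads_single[OF one_neq_zero, of 0] by simp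
next
  case (Cons i l)
  have "leads 1 (case_gen a b i) (case_gen f g i)"
    using assms by (cases i) auto
  from leads_mult[OF this Cons.IH] show ?case
    by simp
qed

text \<open>If the leading words \<open>a\<close> and \<open>b\<close> form a code, then among the leading words of the terms of
  \<open>p(f, g)\<close> the largest one occurs only once, so its coefficient cannot cancel.\<close>

lemma algebraically_independent_if_code:
  assumes f: "leads 1 a f" and g: "leads 1 b g"
    and code: "inj (\<lambda>l. sum_list (map (case_gen a b) l))"
  shows "algebraically_independent f g"
proof
  define lw where "lw = (\<lambda>m. sum_list (map (case_gen a b) (letters m)))"
  assume "algebraically_dependent f g"
  then obtain p where p: "p \<noteq> 0" "substitute p f g = 0"
    unfolding algebraically_dependent_def by blast
  define t where "t = (\<lambda>m. scalar (Poly_Mapping.lookup p m) *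
        prod_list (map (case_gen f g) (letters m)))"
  have t: "leads (Poly_Mapping.lookup p m) (lw m) (t m)" if "m \<in> Poly_Mapping.keys p" for m
  proof -
    have "leads (Poly_Mapping.lookup p m) 0 (scalar (Poly_Mapping.lookup p m))"
      using that by (simp add: leads_scalar in_keys_iff)
    from leads_mult[OF this leads_monomial_value[OF f g]] show ?thesis
      by (simp add: t_def lw_def)
  qed
  obtain n where n: "n \<in> Poly_Mapping.keys p"
      and max: "\<And>m. m \<in> Poly_Mapping.keys p \<Longrightarrow> lw m = lw n \<or> lw m \<prec> lw n"
    using finite_maximum[of "lw ` Poly_Mapping.keys p"] p(1) by auto
  have other: "Poly_Mapping.lookup (t m) (lw n) = 0"
    if m: "m \<in> Poly_Mapping.keys p" "m \<noteq> n" for m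
  proof -
    have "lw m \<noteq> lw n"
      using m(2) injD[OF code, of "letters m" "letters n"] by (auto simp: lw_def word.expand)
    then have "lw m \<prec> lw n"
      using max m(1) by blast
    then have "lw n \<notin> Poly_Mapping.keys (t m)"
      using leads_keys[OF t[OF m(1)]] irrefl trans by metis
    then show ?thesis
      by (simp add: in_keys_iff)
  qed
  have "Poly_Mapping.lookup (substitute p f g) (lw n)
      = (\<Sum>m\<in>Poly_Mapping.keys p. Poly_Mapping.lookup (t m) (lw n))"
    by (simp add: substitute_def t_def lookup_sum)
  also have "\<dots> = Poly_Mapping.lookup (t n) (lw n)"
    using n other by (subst sum.remove[of _ n]) auto
  also have "\<dots> = Poly_Mapping.lookup p n"
    by (rule leads_lookup[OF t[OF n]])
  finally show False
    using p(2) n by (simp add: in_keys_iff)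
qed

text \<open>The leading word of an element commuting with \<open>f\<close> is that of some \<open>f\<^sup>n\<close>, and subtracting a
  multiple of \<open>f\<^sup>n\<close> leads to a smaller exponent.\<close>

lemma in_subalgebra_if_commutes:
  assumes f: "leads 1 w f" and pos: "0 \<prec> w"
    and prim: "\<And>v. v + w = w + v \<Longrightarrow> \<exists>n. v = sum_list (replicate n w)"
    and T: "unital_subalgebra T" "f \<in> T"
    and comm: "f * a = a * f"
  shows "a \<in> T"
proof -
  have power_in: "f ^ n \<in> T" for n
    using T by (induction n) (auto simp: unital_subalgebra_def)
  have "scalar 0 * f \<in> T"
    using T by (simp add: unital_subalgebra_def)
  then have zero_in: "0 \<in> T"
    by (simp add: scalar_def)
  have leading_power: "\<exists>n. leads (Poly_Mapping.lookup b (sum_list (replicate n w)))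
      (sum_list (replicate n w)) b" if b: "b \<noteq> 0" "f * b = b * f" for b
  proof -
    obtain v where v: "leads (Poly_Mapping.lookup b v) v b"
      using leads_exists[OF b(1)] .
    have "v + w = w + v"
      using leads_unique[OF leads_mult[OF v f]] leads_mult[OF f v] b(2) by simp
    then obtain n where "v = sum_list (replicate n w)"
      using prim by blast
    with v show ?thesis
      by auto
  qed
  have "b \<in> T" if "leads c (sum_list (replicate n w)) b" "f * b = b * f" for n b c
    using that
  proof (induction n arbitrary: b c rule: less_induct)
    case (less n)
    define d where "d = b - scalar c * f ^ n"
    have "leads (c * 1) (0 + sum_list (replicate n w)) (scalar c * f ^ n)"
      by (intro leads_mult leads_scalar leads_power f leads_nonzero[OF less.prems(1)])
    then have below: "below (sum_list (replicate n w)) d"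
      using below_diff_if_leads[OF less.prems(1)] by (simp add: d_def)
    have scalar_central: "f * scalar c = scalar c * f"
      by (rule scalar_commute)
    have "f * (scalar c * f ^ n) = (scalar c * f ^ n) * f"
      by (metis scalar_central mult.assoc power_commutes)
    then have d_comm: "f * d = d * f"
      using less.prems(2) by (simp add: d_def algebra_simps)
    have "d \<in> T"
    proof (cases "d = 0")
      case False
      obtain m where m: "leads (Poly_Mapping.lookup d (sum_list (replicate m w)))
          (sum_list (replicate m w)) d"
        using leading_power[OF False d_comm] by blast
      then have "sum_list (replicate m w) \<prec> sum_list (replicate n w)"
        using below leads_in_keys by (auto simp: below_def)
      then have "m < n"
        by (rule multiples_strict_mono_inverse[OF pos])
      then show ?thesis
        using less.IH m d_comm by blast
    qed (simp add: zero_in)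
    moreover have "scalar c * f ^ n \<in> T"
      using T(1) power_in by (simp add: unital_subalgebra_def)
    ultimately have "d + scalar c * f ^ n \<in> T"
      using T(1) by (simp add: unital_subalgebra_def)
    then show ?case
      by (simp add: d_def)
  qed
  then show ?thesis
    using leading_power[of a] comm zero_in by blast
qed

lemma generates_centralizer_if_primitive_leading_word:
  assumes "leads 1 w f" "0 \<prec> w"
    and "\<And>v. v + w = w + v \<Longrightarrow> \<exists>n. v = sum_list (replicate n w)"
  shows "generates_centralizer f"
  unfolding generates_centralizer_def
proof
  show "centralizer f \<subseteq> unital_subalgebra hull {f}"
    using in_subalgebra_if_commutes[OF assms] by (auto simp: hull_def centralizer_def)
  show "unital_subalgebra hull {f} \<subseteq> centralizer f"
    using unital_subalgebra_centralizer[of f] by (intro hull_minimal) (auto simp: centralizer_def)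
qed

end

section \<open>The two polynomials as sums of words\<close>

abbreviation monomial :: "gen list \<Rightarrow> 'k::field free_algebra" where
  "monomial l \<equiv> Poly_Mapping.single (Word l) 1"

lemma monomial_mult: "monomial l * monomial m = monomial (l @ m)"
  by (simp add: mult_single plus_word_def)

text \<open>The word \<open>(xy)\<^sup>k x\<close>, bracketed as \<open>x(yx)\<^sup>k\<close> so that its first letter is visible to the
  simplifier.\<close>

definition u_letters :: "nat \<Rightarrow> gen list" where
  "u_letters k = X # concat (replicate k [Y, X])"

lemma length_u_letters: "length (u_letters k) = 2 * k + 1"
  by (induction k) (simp_all add: u_letters_def)

lemma u_poly_monomial: "u_poly k = (monomial (u_letters k) :: 'k::field free_algebra)"
proof (induction k)
  case 0
  show ?case
    by (simp add: u_poly_def u_letters_def var_def)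
next
  case (Suc k)
  then have "u_poly (Suc k) = var X * var Y * (monomial (u_letters k) :: 'k free_algebra)"
    by (simp add: u_poly_def mult.assoc)
  then show ?case
    by (simp add: var_def monomial_mult u_letters_def)
qed

lemma v_poly_monomial: "v_poly = monomial [X, Y]"
  by (simp add: v_poly_def var_def monomial_mult)

lemma w_poly_monomial: "w_poly = monomial [Y, X]"
  by (simp add: w_poly_def var_def monomial_mult)

lemma f_poly_monomials:
  "f_poly k = monomial ([Y, X] @ u_letters k) + (monomial (u_letters k @ u_letters k @ u_letters k)
     + monomial (u_letters k @ [X, Y]) + monomial (u_letters k @ [Y, X]))"
  by (simp add: f_poly_def r_poly_def power3_eq_cube u_poly_monomial v_poly_monomial
      w_poly_monomial monomial_mult add_ac)

lemma g_poly_monomials: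
  "g_poly k = monomial [Y, X] + (monomial (u_letters k @ u_letters k) + monomial [X, Y])"
  by (simp add: g_poly_def s_poly_def power2_eq_square u_poly_monomial v_poly_monomial
      w_poly_monomial monomial_mult add_ac)

text \<open>This identity makes the parts of degree above \<open>2k + 5\<close> in the commutator cancel.\<close>

lemma v_u_eq_u_w: "v_poly * u_poly k = u_poly k * w_poly"
proof -
  have "[X, Y] @ u_letters k = u_letters k @ [Y, X]"
    by (induction k) (simp_all add: u_letters_def)
  then show ?thesis
    by (simp add: u_poly_monomial v_poly_monomial w_poly_monomial monomial_mult)
qed

section \<open>The weighted word order\<close>

definition weight :: "nat \<Rightarrow> gen list \<Rightarrow> int" where
  "weight k l = (\<Sum>i\<leftarrow>l. case i of X \<Rightarrow> - int k | Y \<Rightarrow> int k + 1)"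

lemma weight_simps [simp]:
  "weight k [] = 0"
  "weight k (X # l) = weight k l - int k"
  "weight k (Y # l) = weight k l + int k + 1"
  "weight k (l @ m) = weight k l + weight k m"
  by (simp_all add: weight_def)

definition weight_less :: "nat \<Rightarrow> gen word \<Rightarrow> gen word \<Rightarrow> bool" where
  "weight_less k a b \<longleftrightarrow> weight k (letters a) < weight k (letters b)
     \<or> weight k (letters a) = weight k (letters b) \<and> (letters a, letters b) \<in> lenlex {(X, Y)}"

text \<open>Once the weights agree, words of different length can still occur.  Comparing lengths
  before letters keeps the order compatible with multiplication from the right, which the
  dictionary order alone is not.\<close>

interpretation weighted: ordered_words "weight_less k" for k
proof
  fix a b c :: "gen word"
  have irr: "irrefl {(X, Y)}" and tr: "Relation.trans {(X, Y)}"
    by (auto simp: irrefl_def trans_def)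
  have "i = j \<or> (i, j) \<in> {(X, Y)} \<or> (j, i) \<in> {(X, Y)}" for i j
    by (cases i; cases j) auto
  then have tot: "total {(X, Y)}"
    by (auto simp: total_on_def)
  show "\<not> weight_less k a a"
    using lenlex_irreflexive[of "{(X, Y)}" "letters a"] by (auto simp: weight_less_def)
  show "weight_less k a c" if "weight_less k a b" "weight_less k b c"
    using that lenlex_trans[OF _ _ tr] by (auto simp: weight_less_def)
  show "weight_less k a b \<or> weight_less k b a" if "a \<noteq> b"
  proof -
    have "letters a \<noteq> letters b"
      using that word.expand by blast
    then have "(letters a, letters b) \<in> lenlex {(X, Y)} \<or> (letters b, letters a) \<in> lenlex {(X, Y)}"
      using total_lenlex[OF tot] by (simp add: total_on_def)
    then show ?thesis
      by (auto simp: weight_less_def)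
  qed
  show "weight_less k (c + a) (c + b)" if "weight_less k a b"
    using that irr by (auto simp: weight_less_def plus_word_def)
  show "weight_less k (a + c) (b + c)" if "weight_less k a b"
    using that by (auto simp: weight_less_def plus_word_def intro: lenlex_append1)
qed

lemma weight_concat_replicate: "weight k (concat (replicate n l)) = int n * weight k l"
  by (induction n) (simp_all add: algebra_simps)

lemma weight_u_letters: "weight k (u_letters k) = 0"
  by (simp add: u_letters_def weight_concat_replicate)

lemma leads_f_poly: "weighted.leads k 1 (Word ([Y, X] @ u_letters k)) (f_poly k)"
  unfolding f_poly_monomials
proof (intro weighted.leads_add_below weighted.leads_single weighted.below_add
    weighted.below_single one_neq_zero)
  let ?top = "Word ([Y, X] @ u_letters k)"
  show "weight_less k (Word (u_letters k @ u_letters k @ u_letters k)) ?top"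
    by (simp add: weight_less_def weight_u_letters)
  show "weight_less k (Word (u_letters k @ [X, Y])) ?top"
    by (simp add: weight_less_def weight_u_letters)
      (simp add: u_letters_def Cons_lenlex_iff)
  show "weight_less k (Word (u_letters k @ [Y, X])) ?top"
    by (simp add: weight_less_def weight_u_letters)
      (simp add: u_letters_def Cons_lenlex_iff)
qed

lemma leads_g_poly: "weighted.leads k 1 (Word [Y, X]) (g_poly k)"
  unfolding g_poly_monomials
proof (intro weighted.leads_add_below weighted.leads_single weighted.below_add
    weighted.below_single one_neq_zero)
  show "weight_less k (Word (u_letters k @ u_letters k)) (Word [Y, X])"
    by (simp add: weight_less_def weight_u_letters)
  show "weight_less k (Word [X, Y]) (Word [Y, X])"
    by (simp add: weight_less_def Cons_lenlex_iff)
qed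

lemma letters_sum_list: "letters (sum_list ws) = concat (map letters ws)"
  by (induction ws) (simp_all add: zero_word_def plus_word_def)

lemma weight_one_primitive:
  assumes w: "weight k (letters w) = 1" and comm: "v + w = w + v"
  shows "\<exists>n. v = sum_list (replicate n w)"
proof -
  have "letters v @ letters w = letters w @ letters v"
    using comm by (simp add: plus_word_def)
  then obtain m n z where v: "letters v = concat (replicate m z)"
      and wz: "letters w = concat (replicate n z)"
    using comm_append_are_replicate by metis
  have "int n * weight k z = 1"
    using w by (simp add: wz weight_concat_replicate)
  then have "n = 1"
    using zmult_eq_1_iff[of "int n" "weight k z"] by auto
  then have "letters v = letters (sum_list (replicate m w))"
    using v wz by (simp add: letters_sum_list)
  then show ?thesis
    using word.expand by blast
qed

lemma generates_centralizer_if_leads_weight_one: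
  assumes "weighted.leads k 1 w p" "weight k (letters w) = 1"
  shows "generates_centralizer p"
  using assms weight_one_primitive
  by (intro weighted.generates_centralizer_if_primitive_leading_word[of k w])
    (auto simp: weight_less_def zero_word_def)

text \<open>Both words begin with \<open>yx\<close>.  If an \<open>x\<close> follows, it must be the first letter of \<open>u\<close>, and the
  word being read is \<open>wu\<close>; if a \<open>y\<close> or nothing follows, it is \<open>w\<close>.\<close>

lemma leading_words_code:
  "inj (\<lambda>l. sum_list (map (case_gen (Word ([Y, X] @ u_letters k)) (Word [Y, X])) l))"
proof (rule injI)
  define \<phi> where "\<phi> = (\<lambda>l. concat (map (case_gen ([Y, X] @ u_letters k) [Y, X]) l))"
  have letters_eq:
    "letters (sum_list (map (case_gen (Word ([Y, X] @ u_letters k)) (Word [Y, X])) l)) = \<phi> l" for l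
  proof (induction l)
    case (Cons i l)
    then show ?case
      by (cases i) (simp_all add: \<phi>_def plus_word_def)
  qed (simp add: \<phi>_def zero_word_def)
  have not_X: "\<phi> l \<noteq> X # t" for l t
    by (cases l) (auto simp: \<phi>_def split: gen.splits)
  have clash: "u_letters k @ s \<noteq> \<phi> l" for s l
    using not_X[of l] by (simp add: u_letters_def) metis
  have inj: "\<phi> l = \<phi> l' \<Longrightarrow> l = l'" for l l'
  proof (induction l arbitrary: l')
    case Nil
    then show ?case
      by (cases l') (auto simp: \<phi>_def split: gen.splits)
  next
    case (Cons i l)
    note IH = Cons.IH
    have "\<phi> (i # l) \<noteq> []"
      by (auto simp: \<phi>_def split: gen.splits)
    with Cons.prems obtain j m where l': "l' = j # m"
      by (cases l') (auto simp: \<phi>_def)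
    have step: "\<phi> (X # p) = [Y, X] @ u_letters k @ \<phi> p" "\<phi> (Y # p) = [Y, X] @ \<phi> p" for p
      by (simp_all add: \<phi>_def)
    show ?case
      using Cons.prems IH[of m] clash[of "\<phi> l" m] clash[of "\<phi> m" l]
      by (cases i; cases j) (auto simp: l' step)
  qed
  fix l l'
  assume "sum_list (map (case_gen (Word ([Y, X] @ u_letters k)) (Word [Y, X])) l)
    = sum_list (map (case_gen (Word ([Y, X] @ u_letters k)) (Word [Y, X])) l')"
  then show "l = l'"
    using inj letters_eq by metis
qed

section \<open>Degrees and leading forms\<close>

lemma deg_eqI:
  assumes "Word l \<in> Poly_Mapping.keys p" "length l = d"
    and "\<And>m. m \<in> Poly_Mapping.keys p \<Longrightarrow> length (letters m) \<le> d"
  shows "deg p = d"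
  unfolding deg_def
proof (rule Max_eqI)
  show "d \<in> insert 0 ((\<lambda>m. length (letters m)) ` Poly_Mapping.keys p)"
    using assms(1,2) by (force simp: image_iff)
qed (use assms(3) in auto)

lemma lookup_homogeneous_component:
  "Poly_Mapping.lookup (homogeneous_component d p) m
     = (if length (letters m) = d then Poly_Mapping.lookup p m else 0)"
  by (simp add: homogeneous_component_def lookup_sum lookup_single when_def in_keys_iff)

lemma deg_and_leading_form:
  assumes "length l = d" "\<And>m. m \<in> Poly_Mapping.keys q \<Longrightarrow> length (letters m) < d"
  shows "deg (monomial l + q) = d" "leading_form (monomial l + q) = monomial l"
proof -
  have q: "Poly_Mapping.lookup q m = 0" if "length (letters m) = d" for m
    using assms(2)[of m] that by (auto simp: in_keys_iff)
  show deg: "deg (monomial l + q) = d"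
  proof (rule deg_eqI[of l])
    show "Word l \<in> Poly_Mapping.keys (monomial l + q)"
      using q[of "Word l"] assms(1) by (simp add: in_keys_iff lookup_add)
    show "length (letters m) \<le> d" if "m \<in> Poly_Mapping.keys (monomial l + q)" for m
      using that assms keys_add[of "monomial l" q] by (fastforce split: if_splits)
  qed (rule assms(1))
  show "leading_form (monomial l + q) = monomial l"
    unfolding leading_form_def deg using q assms(1)
    by (intro poly_mapping_eqI)
      (auto simp: lookup_homogeneous_component lookup_add lookup_single when_def)
qed

lemma f_poly_deg_leading_form:
  assumes "k \<ge> 1"
  shows "deg (f_poly k :: 'k::field free_algebra) = 6 * k + 3"
    "leading_form (f_poly k) = (monomial (u_letters k @ u_letters k @ u_letters k) :: 'k free_algebra)"
proof -
  let ?l = "u_letters k @ u_letters k @ u_letters k"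
  let ?q = "monomial ([Y, X] @ u_letters k) + monomial (u_letters k @ [X, Y])
     + monomial (u_letters k @ [Y, X]) :: 'k free_algebra"
  have f: "f_poly k = monomial ?l + ?q"
    by (simp add: f_poly_monomials add_ac)
  have "length (letters m) < 6 * k + 3" if "m \<in> Poly_Mapping.keys ?q" for m
    using that assms by (auto simp: length_u_letters dest!: subsetD[OF keys_add])
  then show "deg (f_poly k :: 'k free_algebra) = 6 * k + 3"
      "leading_form (f_poly k) = (monomial ?l :: 'k free_algebra)"
    unfolding f using deg_and_leading_form[of ?l "6 * k + 3" ?q] by (simp_all add: length_u_letters)
qed

lemma g_poly_deg_leading_form:
  assumes "k \<ge> 1"
  shows "deg (g_poly k :: 'k::field free_algebra) = 4 * k + 2"
    "leading_form (g_poly k) = (monomial (u_letters k @ u_letters k) :: 'k free_algebra)"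
proof -
  let ?l = "u_letters k @ u_letters k"
  let ?q = "monomial [Y, X] + monomial [X, Y] :: 'k free_algebra"
  have g: "g_poly k = monomial ?l + ?q"
    by (simp add: g_poly_monomials add_ac)
  have "length (letters m) < 4 * k + 2" if "m \<in> Poly_Mapping.keys ?q" for m
    using that assms by (auto simp: length_u_letters dest!: subsetD[OF keys_add])
  then show "deg (g_poly k :: 'k free_algebra) = 4 * k + 2"
      "leading_form (g_poly k) = (monomial ?l :: 'k free_algebra)"
    unfolding g using deg_and_leading_form[of ?l "4 * k + 2" ?q] by (simp_all add: length_u_letters)
qed

text \<open>The relation is \<open>Y\<^sup>3 - X\<^sup>2\<close>.\<close>

lemma algebraically_dependent_if_square_eq_cube:
  assumes "a * a = b * b * b"
  shows "algebraically_dependent a b"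
proof -
  define p :: "'a free_algebra" where
    "p = Poly_Mapping.single (Word [Y, Y, Y]) 1 - Poly_Mapping.single (Word [X, X]) 1"
  have lookup: "Poly_Mapping.lookup p m
      = (if m = Word [Y, Y, Y] then 1 else if m = Word [X, X] then - 1 else 0)" for m
    by (auto simp: p_def lookup_minus lookup_single when_def)
  have keys: "Poly_Mapping.keys p = {Word [Y, Y, Y], Word [X, X]}"
    by (auto simp: in_keys_iff lookup split: if_splits)
  have "scalar 1 = (1 :: 'a free_algebra)" "scalar (- 1) = (- 1 :: 'a free_algebra)"
    by (simp_all add: scalar_def single_uminus)
  then have "substitute p a b = 0"
    using assms by (simp add: substitute_def keys lookup mult.assoc)
  moreover have "p \<noteq> 0"
    using keys by auto
  ultimately show ?thesis
    unfolding algebraically_dependent_def by blast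
qed

section \<open>The commutator\<close>

lemma commutator_identity:
  fixes u v w :: "'r::ring_1"
  assumes "v * u = u * w"
  defines "f \<equiv> u ^ 3 + (u * v + u * w + w * u)" and "g \<equiv> u ^ 2 + (v + w)"
  shows "f * g - g * f = u * v * v + u * v * w - v * w * u - w * w * u"
proof -
  have "v * (u * z) = u * (w * z)" for z
    using assms(1) by (metis mult.assoc)
  then show ?thesis
    unfolding f_def g_def
    by (simp add: assms(1) algebra_simps power2_eq_square power3_eq_cube)
qed

lemma commutator_f_g_monomials:
  "commutator (f_poly k) (g_poly k)
     = monomial (u_letters k @ [X, Y, X, Y]) + monomial (u_letters k @ [X, Y, Y, X])
       - monomial ([X, Y, Y, X] @ u_letters k) - monomial ([Y, X, Y, X] @ u_letters k)"
proof -
  have "commutator (f_poly k) (g_poly k) = u_poly k * v_poly * v_poly + u_poly k * v_poly * w_poly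
      - v_poly * w_poly * u_poly k - w_poly * w_poly * u_poly k"
    unfolding commutator_def f_poly_def g_poly_def r_poly_def s_poly_def
    by (rule commutator_identity[OF v_u_eq_u_w])
  then show ?thesis
    by (simp add: u_poly_monomial v_poly_monomial w_poly_monomial monomial_mult)
qed

lemma deg_commutator_f_g:
  assumes "k \<ge> 1"
  shows "deg (commutator (f_poly k) (g_poly k)) = 2 * k + 5"
proof (rule deg_eqI[of "u_letters k @ [X, Y, X, Y]"])
  obtain j where k: "k = Suc j"
    using assms by (cases k) auto
  \<comment> \<open>The word \<open>uvv\<close> cannot cancel: it differs from \<open>uvw\<close> in the last two letters and from
    \<open>vwu\<close> and \<open>wwu\<close> within the first three, as \<open>u\<close> begins with \<open>xyx\<close>.\<close>
  show "Word (u_letters k @ [X, Y, X, Y]) \<in> Poly_Mapping.keys (commutator (f_poly k) (g_poly k))"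
    by (simp add: commutator_f_g_monomials in_keys_iff lookup_minus lookup_add lookup_single when_def)
      (simp add: u_letters_def k)
  show "length (letters m) \<le> 2 * k + 5"
    if "m \<in> Poly_Mapping.keys (commutator (f_poly k) (g_poly k))" for m
    using that unfolding commutator_f_g_monomials
    by (auto simp: length_u_letters dest!: subsetD[OF keys_add] subsetD[OF keys_diff])
qed (simp add: length_u_letters)

section \<open>The properties of the pair\<close>

theorem theorem3p1:
  fixes k :: nat
    and f g :: "nat \<Rightarrow> 'k::field_char_0 free_algebra"
    and q :: "nat \<Rightarrow> real"
  assumes "k \<ge> 2"
    and f: "\<And>n. f n = f_poly n"
    and g: "\<And>n. g n = g_poly n"
    and q: "\<And>n. q n = real (deg (commutator (f n) (g n))) / real (deg (g n))"
  shows "algebraically_independent (f k) (g k)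
    \<and> generates_centralizer (f k) \<and> generates_centralizer (g k)
    \<and> algebraically_dependent (leading_form (f k)) (leading_form (g k))
    \<and> \<not> deg (f k) dvd deg (g k) \<and> \<not> deg (g k) dvd deg (f k)
    \<and> deg (commutator (f k) (g k)) < deg (g k) \<and> deg (g k) < deg (f k)
    \<and> q k = 1/2 + 2 / (2 * real k + 1)
    \<and> q k > 1/2
    \<and> q \<longlonglongrightarrow> 1/2"
proof -
  have deg_f: "deg (f k) = 6 * k + 3" and deg_g: "deg (g k) = 4 * k + 2"
    and deg_c: "deg (commutator (f k) (g k)) = 2 * k + 5"
    using assms(1)
    by (simp_all add: f g f_poly_deg_leading_form(1) g_poly_deg_leading_form(1) deg_commutator_f_g)
  have quotient: "q n = 1/2 + 2 / (2 * real n + 1)" if "n \<ge> 1" for n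
    using that by (simp add: q f g g_poly_deg_leading_form(1) deg_commutator_f_g field_simps)
  have "algebraically_independent (f k) (g k)"
    unfolding f g
    by (rule weighted.algebraically_independent_if_code[OF leads_f_poly leads_g_poly
          leading_words_code])
  moreover have "generates_centralizer (f k)"
    unfolding f by (rule generates_centralizer_if_leads_weight_one[OF leads_f_poly])
      (simp add: weight_u_letters)
  moreover have "generates_centralizer (g k)"
    unfolding g by (rule generates_centralizer_if_leads_weight_one[OF leads_g_poly]) simp
  moreover have "algebraically_dependent (leading_form (f k)) (leading_form (g k))"
    using assms(1) unfolding f g
    by (intro algebraically_dependent_if_square_eq_cube)
      (simp add: f_poly_deg_leading_form(2) g_poly_deg_leading_form(2) monomial_mult)
  moreover have "\<not> deg (f k) dvd deg (g k)"
    by (rule nat_dvd_not_less) (use assms(1) deg_f deg_g in auto)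
  moreover have "\<not> deg (g k) dvd deg (f k)"
  proof
    assume "deg (g k) dvd deg (f k)"
    moreover have "2 dvd deg (g k)"
      by (simp add: deg_g)
    ultimately have "2 dvd deg (f k)"
      using dvd_trans by blast
    then show False
      by (simp add: deg_f)
  qed
  moreover have "q \<longlonglongrightarrow> 1/2"
  proof -
    have "(\<lambda>n. inverse (real (Suc (2 * n)))) \<longlonglongrightarrow> 0"
      using LIMSEQ_subseq_LIMSEQ[OF LIMSEQ_inverse_real_of_nat, of "\<lambda>n. 2 * n"]
      by (simp add: strict_mono_def comp_def)
    then have "(\<lambda>n. 1/2 + 2 * inverse (real (Suc (2 * n)))) \<longlonglongrightarrow> 1/2 + 2 * 0"
      by (intro tendsto_intros)
    moreover have "\<forall>\<^sub>F n in sequentially. 1/2 + 2 * inverse (real (Suc (2 * n))) = q n"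
      using quotient by (intro eventually_sequentiallyI[of 1]) (simp add: field_simps)
    ultimately show ?thesis
      by (simp add: tendsto_cong)
  qed
  ultimately show ?thesis
    using assms(1) deg_f deg_g deg_c quotient[of k] by simp
qed

end
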